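(* Let $N, M, R$ be positive integers with $M \le N$, $R$ a power of $2$, $n = N\log_2 R$ and $m = M\log_2 R$, and let $\delta\in(0,1)$. Suppose $\psi:\{-1,1\}^n\to\mathbb{R}$ is a $(1-\delta,d)$-dual polynomial for $\operatorname{Col}_{N,R}$. If $M \ge 2\sqrt{N\ln(2/\delta)}$, then there exists $\varphi:\{-1,1\}^m\to\mathbb{R}$ (constructed explicitly from $\psi$) that is a $(1-2\delta,d)$-dual polynomial for $\operatorname{ED}_{M,R}$.
   Context: An input $x\in\{-1,1\}^{K\log_2 R}$ is split into $K$ consecutive blocks of $\log_2 R$ bits, each read (via binary representation) as an element of $[R]=\{1,\dots,R\}$, so $x$ encodes a function $g_x:[K]\to[R]$. $g_x$ is $k$-to-$1$ if each $i$ has exactly $k-1$ other $j$ with $g_x(j)=g_x(i)$. For the collision problem ($K=N$): $T_k=\{x\in\{-1,1\}^n: g_x\text{ is }k\text{-to-}1\}$, $B=\{-1,1\}^n\setminus(T_1\cup T_2)$, and $\operatorname{Col}_{N,R}$ is the partial function on $T_1\cup T_2$ equal to $1$ on $T_1$ and $-1$ on $T_2$. A function $\psi:\{-1,1\}^n\to\mathbb{R}$ is an $(\varepsilon,d)$-dual polynomial for $\operatorname{Col}_{N,R}$ if $\sum_{x\in T_1}\psi(x)-\sum_{x\in T_2}\psi(x)-\sum_{x\in B}|\psi(x)|>\varepsilon\sum_x|\psi(x)|$ and $\sum_x\psi(x)\chi_S(x)=0$ for every $S\subseteq[n]$ with $|S|\le d$, where $\chi_S(x)=\prod_{i\in S}x_i$.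 The Element Distinctness function $\operatorname{ED}_{M,R}:\{-1,1\}^m\to\{-1,1\}$ ($K=M$) equals $1$ iff $g_x$ is $1$-to-$1$ and $-1$ otherwise. A function $\varphi:\{-1,1\}^m\to\mathbb{R}$ is an $(\varepsilon,d)$-dual polynomial for $\operatorname{ED}_{M,R}$ if $\sum_x\varphi(x)\operatorname{ED}_{M,R}(x)>\varepsilon\sum_x|\varphi(x)|$ and $\sum_x\varphi(x)\chi_S(x)=0$ for every $S\subseteq[m]$ with $|S|\le d$. *)

theory Defs
  imports Complex_Main "HOL-Library.FuncSet"
begin

definition cube :: "nat \<Rightarrow> (nat \<Rightarrow> real) set" where
  "cube n = {1..n} \<rightarrow>\<^sub>E {-1, 1}"

definition chi :: "nat set \<Rightarrow> (nat \<Rightarrow> real) \<Rightarrow> real" where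
  "chi S x = (\<Prod>i\<in>S. x i)"

text \<open>The floor only serves to obtain a natural number; it is exact for \<open>R\<close> a power of 2.\<close>

definition block_len :: "nat \<Rightarrow> nat" where
  "block_len R = nat \<lfloor>log 2 (real R)\<rfloor>"

lemma block_len_eq_log:
  assumes "\<exists>k. R = 2 ^ k"
  shows "real (block_len R) = log 2 (real R)"
  using assms by (auto simp: block_len_def log_nat_power)

definition input_len :: "nat \<Rightarrow> nat \<Rightarrow> nat" where
  "input_len K R = K * block_len R"

text \<open>
  Block \<open>i \<in> {1..K}\<close> occupies the positions \<open>(i - 1) * l + 1, \<dots>, i * l\<close> with \<open>l = block_len R\<close>.
  It is read most significant bit first, with \<open>-1\<close> as the bit 1 and \<open>1\<close> as the bit 0, and the
  value is shifted by one so as to lie in \<open>{1..R}\<close>.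
\<close>

definition enc_fun :: "nat \<Rightarrow> (nat \<Rightarrow> real) \<Rightarrow> nat \<Rightarrow> nat" where
  "enc_fun R x i = 1 + (\<Sum>j<block_len R.
     (if x ((i - 1) * block_len R + 1 + j) = -1 then 1 else 0) * 2 ^ (block_len R - 1 - j))"

definition k_to_1 :: "nat \<Rightarrow> nat \<Rightarrow> (nat \<Rightarrow> nat) \<Rightarrow> bool" where
  "k_to_1 k K g \<longleftrightarrow> (\<forall>i\<in>{1..K}. card {j\<in>{1..K}. j \<noteq> i \<and> g j = g i} + 1 = k)"

definition T_set :: "nat \<Rightarrow> nat \<Rightarrow> nat \<Rightarrow> (nat \<Rightarrow> real) set" where
  "T_set k N R = {x \<in> cube (input_len N R). k_to_1 k N (enc_fun R x)}"

definition B_set :: "nat \<Rightarrow> nat \<Rightarrow> (nat \<Rightarrow> real) set" where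
  "B_set N R = cube (input_len N R) - (T_set 1 N R \<union> T_set 2 N R)"

definition ED :: "nat \<Rightarrow> nat \<Rightarrow> (nat \<Rightarrow> real) \<Rightarrow> real" where
  "ED M R x = (if k_to_1 1 M (enc_fun R x) then 1 else -1)"

definition pure_high_degree :: "nat \<Rightarrow> nat \<Rightarrow> ((nat \<Rightarrow> real) \<Rightarrow> real) \<Rightarrow> bool" where
  "pure_high_degree n d \<psi> \<longleftrightarrow>
     (\<forall>S. S \<subseteq> {1..n} \<and> card S \<le> d \<longrightarrow> (\<Sum>x\<in>cube n. \<psi> x * chi S x) = 0)"

text \<open>
  Dual polynomials for the partial function \<open>Col\<close> with domain \<open>T_set 1 N R \<union> T_set 2 N R\<close>,
  equal to \<open>1\<close> on \<open>T_set 1 N R\<close> and \<open>-1\<close> on \<open>T_set 2 N R\<close>. Functions on the cube are total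
  functions here; their values outside the cube are never used.
\<close>

definition dual_poly_Col ::
  "nat \<Rightarrow> nat \<Rightarrow> real \<Rightarrow> nat \<Rightarrow> ((nat \<Rightarrow> real) \<Rightarrow> real) \<Rightarrow> bool" where
  "dual_poly_Col N R \<epsilon> d \<psi> \<longleftrightarrow>
     (\<Sum>x\<in>T_set 1 N R. \<psi> x) - (\<Sum>x\<in>T_set 2 N R. \<psi> x) - (\<Sum>x\<in>B_set N R. \<bar>\<psi> x\<bar>)
       > \<epsilon> * (\<Sum>x\<in>cube (input_len N R). \<bar>\<psi> x\<bar>)
     \<and> pure_high_degree (input_len N R) d \<psi>"

definition dual_poly_ED ::
  "nat \<Rightarrow> nat \<Rightarrow> real \<Rightarrow> nat \<Rightarrow> ((nat \<Rightarrow> real) \<Rightarrow> real) \<Rightarrow> bool" where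
  "dual_poly_ED M R \<epsilon> d \<phi> \<longleftrightarrow>
     (\<Sum>x\<in>cube (input_len M R). \<phi> x * ED M R x)
       > \<epsilon> * (\<Sum>x\<in>cube (input_len M R). \<bar>\<phi> x\<bar>)
     \<and> pure_high_degree (input_len M R) d \<phi>"

end

theory Submission
  imports Defs "HOL-Analysis.Harmonic_Numbers" "HOL-Computational_Algebra.Polynomial"
begin

text \<open>
  Let \<open>\<phi>\<close> be the sum of the marginals of \<open>\<psi>\<close> over all ordered choices of \<open>M\<close> distinct blocks.
  A marginal inherits the pure high degree of \<open>\<psi>\<close> and has no larger 1-norm, and pairing \<open>\<phi>\<close> with
  \<open>ED\<close> amounts to pairing \<open>\<psi>\<close> with the number of choices without a collision. By the birthday
  bound a 2-to-1 input has no collision among the chosen blocks with probability at most \<open>\<delta> / 2\<close>,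
  so the pairing loses at most \<open>\<delta>\<close> times the norm of \<open>\<psi>\<close>.

  This requires \<open>1 - 2 * \<delta> \<ge> 0\<close>, since the norm of \<open>\<phi>\<close> is only bounded from above. For
  \<open>\<delta> > 1 / 2\<close> any marginal that is not identically zero works, up to sign. One exists: otherwise
  \<open>\<psi>\<close> would be orthogonal to all functions of \<open>M\<close> blocks, in particular to a bounded combination
  of such functions that agrees with \<open>Col\<close> on its domain, contradicting the positive correlation.
\<close>

section \<open>Restricting an input to a list of blocks\<close>

text \<open>Ordered lists rather than sets: the chosen blocks are numbered and so form an input
  again, and selections can be counted by adding one entry at a time.\<close>

definition selections :: "nat \<Rightarrow> nat \<Rightarrow> nat list set" where
  "selections M N = {us. length us = M \<and> distinct us \<and> set us \<subseteq> {1..N}}"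

text \<open>Positions and block numbers start at 1, list indices and offsets inside a block at 0,
  hence the shifts by one.\<close>

definition select_pos :: "nat \<Rightarrow> nat list \<Rightarrow> nat \<Rightarrow> nat" where
  "select_pos l us p = (us ! ((p - 1) div l) - 1) * l + 1 + (p - 1) mod l"

text \<open>The outer \<open>restrict\<close> makes the result extensional, as membership in
  \<open>cube\<close> demands.\<close>

definition select :: "nat \<Rightarrow> nat list \<Rightarrow> (nat \<Rightarrow> real) \<Rightarrow> nat \<Rightarrow> real" where
  "select R us x =
     restrict (\<lambda>p. x (select_pos (block_len R) us p)) {1..input_len (length us) R}"

text \<open>With \<open>\<psi>\<close> read as a signed measure, this is its image under
  \<open>select R us\<close>.\<close>

definition marginal ::
  "nat \<Rightarrow> nat \<Rightarrow> ((nat \<Rightarrow> real) \<Rightarrow> real) \<Rightarrow> nat list \<Rightarrow> (nat \<Rightarrow> real) \<Rightarrow> real" where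
  "marginal N R \<psi> us y = (\<Sum>x | x \<in> cube (input_len N R) \<and> select R us x = y. \<psi> x)"

lemma finite_cube: "finite (cube n)"
  unfolding cube_def by (intro finite_PiE) auto

lemma finite_selections: "finite (selections M N)"
  unfolding selections_def
  by (rule finite_subset[OF _ finite_lists_length_eq[of "{1..N}" M]]) auto

lemma block_index_less:
  fixes p l M :: nat
  assumes "p \<in> {1..M * l}"
  shows "(p - 1) div l < M" "0 < l"
proof -
  have "p - 1 < M * l" using assms unfolding atLeastAtMost_iff by linarith
  then show "(p - 1) div l < M" by (simp add: less_mult_imp_div_less)
  show "0 < l" using assms by (cases l) auto
qed

lemma select_pos_in:
  assumes "us \<in> selections M N" "p \<in> {1..M * l}"
  shows "select_pos l us p \<in> {1..N * l}"
proof -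
  define a where "a = us ! ((p - 1) div l)"
  define r where "r = (p - 1) mod l"
  note b = block_index_less[OF assms(2)]
  have "a \<in> set us" using b assms(1) by (auto simp: a_def selections_def)
  then have a: "1 \<le> a" "a \<le> N" using assms(1) by (auto simp: selections_def)
  have r: "r < l" using b by (simp add: r_def)
  have "(a - 1) * l + 1 + r \<le> (a - 1) * l + l" using r by simp
  also have "\<dots> = a * l" using a by (cases a) auto
  also have "\<dots> \<le> N * l" using a by simp
  finally show ?thesis by (simp add: select_pos_def a_def r_def)
qed

text \<open>Division by \<open>l\<close> recovers the chosen block and the offset from a position;
  since the entries of \<open>us\<close> are distinct, the block determines its index in the
  list.\<close>

lemma inj_on_select_pos:
  assumes "us \<in> selections M N"
  shows "inj_on (select_pos l us) {1..M * l}"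
proof (rule inj_onI)
  fix p q assume p: "p \<in> {1..M * l}" and q: "q \<in> {1..M * l}"
    and eq: "select_pos l us p = select_pos l us q"
  define i j where "i = (p - 1) div l" and "j = (q - 1) div l"
  note bp = block_index_less[OF p] and bq = block_index_less[OF q]
  have dm: "((a - 1) * l + r mod l) div l = a - 1 \<and> ((a - 1) * l + r mod l) mod l = r mod l"
    for a r :: nat using bp by simp
  have eq': "(us ! i - 1) * l + (p - 1) mod l = (us ! j - 1) * l + (q - 1) mod l"
    using eq by (simp add: select_pos_def i_def j_def)
  have 1: "us ! i - 1 = us ! j - 1" and 2: "(p - 1) mod l = (q - 1) mod l"
    using dm[of "us ! i" "p - 1"] dm[of "us ! j" "q - 1"] eq' by auto
  have "us ! i \<in> set us" "us ! j \<in> set us"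
    using bp bq assms by (auto simp: i_def j_def selections_def)
  then have "1 \<le> us ! i" "1 \<le> us ! j" using assms by (auto simp: selections_def)
  then have "us ! i = us ! j" using 1 by linarith
  then have "i = j"
    using bp bq assms by (auto simp: i_def j_def selections_def nth_eq_iff_index_eq)
  then have "p - 1 = q - 1" using 2 unfolding i_def j_def by (metis div_mult_mod_eq)
  then show "p = q" using p q by auto
qed

lemma select_in_cube:
  assumes "us \<in> selections M N" "x \<in> cube (input_len N R)"
  shows "select R us x \<in> cube (input_len M R)"
proof -
  have "x (select_pos (block_len R) us p) \<in> {-1, 1}" if "p \<in> {1..input_len M R}" for p
    using assms(2) select_pos_in[OF assms(1), of p "block_len R"] that
    unfolding cube_def input_len_def by blast
  moreover have "length us = M" using assms(1) by (simp add: selections_def)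
  ultimately show ?thesis unfolding cube_def select_def by (simp add: restrict_PiE_iff)
qed

lemma enc_fun_select:
  assumes "us \<in> selections M N" "i \<in> {1..M}"
  shows "enc_fun R (select R us x) i = enc_fun R x (us ! (i - 1))"
proof -
  define l where "l = block_len R"
  have "select R us x ((i - 1) * l + 1 + j) = x ((us ! (i - 1) - 1) * l + 1 + j)" if "j < l" for j
  proof -
    have "(i - 1) * l + 1 + j \<le> (i - 1) * l + l" using that by simp
    also have "\<dots> = i * l" using assms(2) by (cases i) auto
    also have "\<dots> \<le> M * l" using assms(2) by simp
    finally have "(i - 1) * l + 1 + j \<in> {1..input_len (length us) R}"
      using assms(1) by (simp add: input_len_def l_def selections_def)
    moreover have "select_pos l us ((i - 1) * l + 1 + j) = (us ! (i - 1) - 1) * l + 1 + j"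
      using that by (simp add: select_pos_def)
    ultimately show ?thesis by (simp add: select_def l_def[symmetric] del: One_nat_def)
  qed
  then show ?thesis unfolding enc_fun_def l_def[symmetric]
    by (intro arg_cong[where f = "\<lambda>s. 1 + s"] sum.cong) auto
qed

section \<open>Pairing marginals with test functions\<close>

lemma k_to_1_1_iff_inj_on: "k_to_1 1 K g \<longleftrightarrow> inj_on g {1..K}"
proof -
  have "card {j \<in> {1..K}. j \<noteq> i \<and> g j = g i} + 1 = 1 \<longleftrightarrow> (\<forall>j\<in>{1..K}. g j = g i \<longrightarrow> j = i)" for i
    by auto
  then have "k_to_1 1 K g \<longleftrightarrow> (\<forall>i\<in>{1..K}. \<forall>j\<in>{1..K}. g j = g i \<longrightarrow> j = i)"
    by (simp only: k_to_1_def)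
  then show ?thesis unfolding inj_on_def by blast
qed

lemma ED_select:
  assumes "us \<in> selections M N"
  shows "ED M R (select R us x) = (if distinct (map (enc_fun R x) us) then 1 else - 1)"
proof -
  have "inj_on (enc_fun R (select R us x)) {1..M}
      \<longleftrightarrow> inj_on (\<lambda>i. enc_fun R x (us ! (i - 1))) (Suc ` {..<M})"
    by (subst inj_on_cong[OF enc_fun_select[OF assms]])
       (auto simp: image_Suc_lessThan)
  also have "\<dots> \<longleftrightarrow> inj_on (\<lambda>i. map (enc_fun R x) us ! i) {..<M}"
    using assms by (auto simp: inj_on_def selections_def)
  also have "\<dots> \<longleftrightarrow> distinct (map (enc_fun R x) us)"
    using assms by (auto simp: inj_on_def selections_def distinct_conv_nth)
  finally show ?thesis by (simp add: ED_def k_to_1_1_iff_inj_on[unfolded One_nat_def])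
qed

text \<open>Change of variables: the inputs are grouped by their restriction. All pairings with a
  marginal are moved back to \<open>\<psi>\<close> this way.\<close>

lemma sum_marginal:
  assumes "us \<in> selections M N"
  shows "(\<Sum>y\<in>cube (input_len M R). marginal N R \<psi> us y * F y) =
    (\<Sum>x\<in>cube (input_len N R). \<psi> x * F (select R us x))"
proof -
  have "(\<Sum>y\<in>cube (input_len M R). marginal N R \<psi> us y * F y) =
    (\<Sum>y\<in>cube (input_len M R). \<Sum>x | x \<in> cube (input_len N R) \<and> select R us x = y.
       \<psi> x * F (select R us x))"
    by (auto simp: marginal_def sum_distrib_right intro!: sum.cong)
  also have "\<dots> = (\<Sum>x\<in>cube (input_len N R). \<psi> x * F (select R us x))"
    using select_in_cube[OF assms] by (intro sum.group finite_cube) auto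
  finally show ?thesis .
qed

text \<open>Triangle inequality in each fibre of \<open>select R us\<close>; cancellation there may
  make the inequality strict.\<close>

lemma sum_abs_marginal_le:
  assumes "us \<in> selections M N"
  shows "(\<Sum>y\<in>cube (input_len M R). \<bar>marginal N R \<psi> us y\<bar>) \<le> (\<Sum>x\<in>cube (input_len N R). \<bar>\<psi> x\<bar>)"
proof -
  have "(\<Sum>y\<in>cube (input_len M R). \<bar>marginal N R \<psi> us y\<bar>) \<le>
    (\<Sum>y\<in>cube (input_len M R). \<Sum>x | x \<in> cube (input_len N R) \<and> select R us x = y. \<bar>\<psi> x\<bar>)"
    unfolding marginal_def by (intro sum_mono sum_abs)
  also have "\<dots> = (\<Sum>x\<in>cube (input_len N R). \<bar>\<psi> x\<bar>)"
    using select_in_cube[OF assms] by (intro sum.group finite_cube) auto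
  finally show ?thesis .
qed

text \<open>A character composed with the restriction is the character of the image positions, and
  \<open>select_pos\<close> is injective, so its degree is unchanged.\<close>

lemma pure_high_degree_marginal:
  assumes "us \<in> selections M N" "pure_high_degree (input_len N R) d \<psi>"
  shows "pure_high_degree (input_len M R) d (marginal N R \<psi> us)"
  unfolding pure_high_degree_def
proof (intro allI impI, elim conjE)
  fix S assume S: "S \<subseteq> {1..input_len M R}" "card S \<le> d"
  define \<pi> where "\<pi> = select_pos (block_len R) us"
  have inj: "inj_on \<pi> S"
    using inj_on_select_pos[OF assms(1)] S(1) unfolding \<pi>_def input_len_def by (rule inj_on_subset)
  have "length us = M" using assms(1) by (simp add: selections_def)
  then have sel: "select R us x p = x (\<pi> p)" if "p \<in> S" for x p
    using S(1) that unfolding select_def \<pi>_def by (simp add: subset_iff)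
  have chi: "chi S (select R us x) = chi (\<pi> ` S) x" for x
    unfolding chi_def prod.reindex[OF inj] by (simp add: sel)
  have "\<pi> ` S \<subseteq> {1..input_len N R}"
    using select_pos_in[OF assms(1)] S(1) unfolding \<pi>_def input_len_def by blast
  moreover have "card (\<pi> ` S) \<le> d" using S(2) card_image[OF inj] by simp
  ultimately have "(\<Sum>x\<in>cube (input_len N R). \<psi> x * chi (\<pi> ` S) x) = 0"
    using assms(2) unfolding pure_high_degree_def by blast
  then show "(\<Sum>y\<in>cube (input_len M R). marginal N R \<psi> us y * chi S y) = 0"
    by (simp add: sum_marginal[OF assms(1)] chi)
qed

section \<open>Counting collision-free selections\<close>

text \<open>The preimage is the union of the fibres through \<open>X\<close>. Each has two points,
  because \<open>k_to_1\<close> counts the points other than \<open>i\<close>, and injectivity on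
  \<open>X\<close> makes them disjoint.\<close>

lemma card_vimage_2_to_1:
  assumes "k_to_1 2 N g" "X \<subseteq> {1..N}" "inj_on g X"
  shows "card {j \<in> {1..N}. g j \<in> g ` X} = 2 * card X"
proof -
  have fib: "card {j \<in> {1..N}. g j = g i} = 2" if "i \<in> X" for i
  proof -
    have i: "i \<in> {1..N}" using that assms(2) by auto
    have "{j \<in> {1..N}. g j = g i} = insert i {j \<in> {1..N}. j \<noteq> i \<and> g j = g i}" using i by auto
    moreover have "i \<notin> {j \<in> {1..N}. j \<noteq> i \<and> g j = g i}" by simp
    ultimately have "card {j \<in> {1..N}. g j = g i} = card {j \<in> {1..N}. j \<noteq> i \<and> g j = g i} + 1"
      by (simp only: card_insert_disjoint finite_Collect_conjI finite_atLeastAtMost Collect_mem_eq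
          Suc_eq_plus1 simp_thms)
    also have "\<dots> = 2" using assms(1) i unfolding k_to_1_def by blast
    finally show ?thesis .
  qed
  have fin: "finite X" using assms(2) finite_subset by blast
  have "{j \<in> {1..N}. g j \<in> g ` X} = (\<Union>i\<in>X. {j \<in> {1..N}. g j = g i})" by auto
  then have "card {j \<in> {1..N}. g j \<in> g ` X} = (\<Sum>i\<in>X. card {j \<in> {1..N}. g j = g i})"
    using assms(3) fin by (simp only:, subst card_UN_disjoint) (auto dest: inj_onD)
  also have "\<dots> = (\<Sum>i\<in>X. 2)" by (intro sum.cong refl fib)
  also have "\<dots> = 2 * card X" by simp
  finally show ?thesis .
qed

lemma card_selections_Suc:
  assumes "k \<le> N"
  shows "card (selections (Suc k) N) = card (selections k N) * (N - k)"
proof -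
  have "selections (Suc k) N = (\<lambda>(us, u). u # us) ` (SIGMA us:selections k N. {1..N} - set us)"
    by (auto simp: selections_def image_iff length_Suc_conv)
  moreover have "inj_on (\<lambda>(us, u). u # us) (SIGMA us:selections k N. {1..N} - set us)"
    by (auto simp: inj_on_def)
  ultimately have "card (selections (Suc k) N) = card (SIGMA us:selections k N. {1..N} - set us)"
    by (simp add: card_image)
  also have "\<dots> = (\<Sum>us\<in>selections k N. card ({1..N} - set us))"
    by (simp add: finite_selections)
  also have "\<dots> = (\<Sum>us\<in>selections k N. N - k)"
    by (intro sum.cong refl) (auto simp: selections_def card_Diff_subset distinct_card)
  finally show ?thesis by simp
qed

text \<open>Each of the \<open>k\<close> chosen blocks forbids itself and its unique partner, and
  these \<open>2 * k\<close> blocks are distinct as long as there is no collision.\<close>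

lemma card_collision_free_Suc:
  assumes "k_to_1 2 N g"
  shows "card {us \<in> selections (Suc k) N. distinct (map g us)} =
    card {us \<in> selections k N. distinct (map g us)} * (N - 2 * k)"
proof -
  define A where "A k = {us \<in> selections k N. distinct (map g us)}" for k
  define E where "E us = {1..N} - {j \<in> {1..N}. g j \<in> g ` set us}" for us
  have "A (Suc k) = (\<lambda>(us, u). u # us) ` (SIGMA us:A k. E us)"
    by (auto simp: A_def E_def selections_def image_iff length_Suc_conv)
  moreover have "inj_on (\<lambda>(us, u). u # us) (SIGMA us:A k. E us)"
    by (auto simp: inj_on_def)
  ultimately have "card (A (Suc k)) = card (SIGMA us:A k. E us)"
    by (simp add: card_image)
  also have "\<dots> = (\<Sum>us\<in>A k. card (E us))"
    by (simp add: finite_selections A_def E_def)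
  also have "\<dots> = (\<Sum>us\<in>A k. N - 2 * k)"
  proof (rule sum.cong[OF refl])
    fix us assume us: "us \<in> A k"
    then have "card {j \<in> {1..N}. g j \<in> g ` set us} = 2 * card (set us)"
      by (intro card_vimage_2_to_1 assms) (auto simp: A_def selections_def distinct_map)
    also have "card (set us) = k" using us by (auto simp: A_def selections_def distinct_card)
    finally show "card (E us) = N - 2 * k" unfolding E_def by (subst card_Diff_subset) auto
  qed
  finally show ?thesis by (simp add: A_def)
qed

text \<open>Extending a selection of length \<open>k\<close> multiplies the collision-free fraction
  by at most \<open>exp (- (k / N))\<close>; the exponents add up to
  \<open>k * (k - 1) / (2 * N)\<close>.\<close>

lemma birthday_bound:
  assumes "k_to_1 2 N g" "k \<le> N"
  shows "real (card {us \<in> selections k N. distinct (map g us)})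
    \<le> real (card (selections k N)) * exp (- (real k * (real k - 1) / (2 * real N)))"
  using assms(2)
proof (induction k)
  case 0
  have "card {us \<in> selections 0 N. distinct (map g us)} \<le> card (selections 0 N)"
    by (intro card_mono finite_selections) auto
  then show ?case by simp
next
  case (Suc k)
  then have k: "k < N" by simp
  \<comment> \<open>The product \<open>(N - k) * (1 - k / N)\<close> equals
    \<open>N - 2 * k + k^2 / N\<close>. If \<open>2 * k\<close> exceeds \<open>N\<close>, the left
    side is 0 by truncated subtraction.\<close>
  have step: "real (N - 2 * k) \<le> real (N - k) * exp (- (real k / real N))"
  proof (cases "2 * k \<le> N")
    case True
    have "real (N - 2 * k) \<le> (real N - real k) * (1 - real k / real N)"
      using k True by (simp add: field_simps)
    also have "\<dots> \<le> (real N - real k) * exp (- (real k / real N))"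
      using k exp_ge_add_one_self[of "- (real k / real N)"] by (intro mult_left_mono) auto
    finally show ?thesis using k by simp
  qed auto
  have "real (card {us \<in> selections (Suc k) N. distinct (map g us)}) \<le>
     (real (card (selections k N)) * exp (- (real k * (real k - 1) / (2 * real N)))) *
     (real (N - k) * exp (- (real k / real N)))"
    unfolding card_collision_free_Suc[OF assms(1)] of_nat_mult
    using Suc k step by (intro mult_mono) auto
  also have "\<dots> = real (card (selections k N) * (N - k)) *
     (exp (- (real k * (real k - 1) / (2 * real N))) * exp (- (real k / real N)))"
    by simp
  also have "exp (- (real k * (real k - 1) / (2 * real N))) * exp (- (real k / real N))
     = exp (- (real (Suc k) * (real (Suc k) - 1) / (2 * real N)))"
    unfolding mult_exp_exp using k by (simp add: field_simps)
  finally show ?case using card_selections_Suc[of k N] k by simp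
qed

text \<open>Makes restrictions to exactly \<open>M\<close> blocks usable for functions of fewer
  blocks; \<open>V = {}\<close> gives the existence of a selection.\<close>

lemma selection_exists:
  assumes "V \<subseteq> {1..N}" "card V \<le> M" "M \<le> N"
  obtains us where "us \<in> selections M N" "V \<subseteq> set us"
proof -
  obtain W where W: "V \<subseteq> W" "W \<subseteq> {1..N}" "card W = M"
    using exists_subset_between[of V M "{1..N}"] assms by auto
  have "finite W" using W finite_subset by blast
  then obtain us where "set us = W" "distinct us" using finite_distinct_list by blast
  then show thesis using W that[of us] by (auto simp: selections_def distinct_card)
qed

section \<open>Exact local polynomials for the collision problem\<close>

lemma chebyshev_poly_exists:
  "\<exists>p :: real poly. degree p \<le> n \<and> (\<forall>\<theta>. poly p (cos \<theta>) = cos (real n * \<theta>))"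
proof (induction n rule: induct_nat_012)
  case 0
  show ?case by (rule exI[of _ 1]) simp
next
  case 1
  show ?case by (rule exI[of _ "[:0, 1:]"]) simp
next
  case (ge2 n)
  then obtain p q :: "real poly" where p: "degree p \<le> n" "\<And>\<theta>. poly p (cos \<theta>) = cos (real n * \<theta>)"
    and q: "degree q \<le> Suc n" "\<And>\<theta>. poly q (cos \<theta>) = cos (real (Suc n) * \<theta>)"
    by blast
  \<comment> \<open>Three-term recurrence: the next polynomial is \<open>2 * x * q - p\<close>, by
    the product-to-sum formula for cosines.\<close>
  have "degree ([:0, 2:] * q) \<le> Suc (Suc n)"
    using degree_mult_le[of "[:0, 2:]" q] q(1) by simp
  then have "degree ([:0, 2:] * q - p) \<le> Suc (Suc n)"
    using p(1) by (intro degree_diff_le) auto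
  moreover have "poly ([:0, 2:] * q - p) (cos \<theta>) = cos (real (Suc (Suc n)) * \<theta>)" for \<theta>
  proof -
    have "2 * (cos \<theta> * cos (real (Suc n) * \<theta>)) = cos (\<theta> - real (Suc n) * \<theta>) + cos (\<theta> + real (Suc n) * \<theta>)"
      by (simp add: cos_times_cos)
    also have "\<theta> - real (Suc n) * \<theta> = - (real n * \<theta>)" by (simp add: algebra_simps)
    also have "\<theta> + real (Suc n) * \<theta> = real (Suc (Suc n)) * \<theta>" by (simp add: algebra_simps)
    finally show ?thesis by (simp add: p(2) q(2))
  qed
  ultimately show ?case by blast
qed

text \<open>Take the Chebyshev polynomial of index \<open>D\<close> at \<open>1 - c * t\<close>. It
  stays within [-1, 1] while \<open>c * t \<le> 2\<close>, and \<open>c \<le> (pi / D)^2 / 4\<close>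
  turns this into the condition on \<open>L\<close>.\<close>

lemma oscillating_poly_exists:
  assumes "D > 0" "(pi / real D)\<^sup>2 * L \<le> 8"
  obtains q :: "real poly" where "degree q \<le> D" "poly q 0 = 1" "poly q 2 = -1"
    "\<And>t. 0 \<le> t \<Longrightarrow> t \<le> L \<Longrightarrow> \<bar>poly q t\<bar> \<le> 1"
proof -
  \<comment> \<open>Chosen so that \<open>t = 2\<close> is sent to \<open>cos (pi / D)\<close>,
    where the Chebyshev polynomial first takes the value -1.\<close>
  define c where "c = (1 - cos (pi / real D)) / 2"
  obtain p :: "real poly" where p: "degree p \<le> D" "\<And>\<theta>. poly p (cos \<theta>) = cos (real D * \<theta>)"
    using chebyshev_poly_exists by blast
  define q where "q = pcompose p [:1, - c:]"
  have q: "poly q t = poly p (1 - c * t)" for t by (simp add: q_def poly_pcompose mult.commute)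
  have c0: "0 \<le> c" by (simp add: c_def)
  have "(sin (pi / (2 * real D)))\<^sup>2 \<le> (pi / (2 * real D))\<^sup>2"
    using abs_sin_x_le_abs_x[of "pi / (2 * real D)"] by (simp only: abs_le_square_iff)
  moreover have "c = (sin (pi / (2 * real D)))\<^sup>2"
    using cos_double_sin[of "pi / (2 * real D)"] by (simp add: c_def)
  ultimately have c1: "c \<le> (pi / real D)\<^sup>2 / 4" by (simp add: power_divide power_mult_distrib)
  have "degree q \<le> degree p * degree [:1, - c:]" unfolding q_def by (rule degree_pcompose_le)
  also have "\<dots> \<le> D * 1" using p(1) by (intro mult_mono) auto
  finally have "degree q \<le> D" by simp
  moreover have "poly q 0 = 1" using p(2)[of 0] by (simp add: q)
  moreover have "1 - c * 2 = cos (pi / real D)" by (simp add: c_def field_simps)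
  then have "poly q 2 = -1" using p(2)[of "pi / real D"] assms(1) by (simp add: q)
  moreover have "\<bar>poly q t\<bar> \<le> 1" if "0 \<le> t" "t \<le> L" for t
  proof -
    have "c * t \<le> (pi / real D)\<^sup>2 / 4 * L" using c0 c1 that by (intro mult_mono) auto
    then have "c * t \<le> 2" using assms(2) by simp
    moreover have "0 \<le> c * t" using c0 that by simp
    ultimately have "cos (arccos (1 - c * t)) = 1 - c * t" by (intro cos_arccos) auto
    then have "poly q t = cos (real D * arccos (1 - c * t))" using p(2) q by metis
    then show ?thesis by simp
  qed
  ultimately show thesis by (rule that)
qed

section \<open>Orthogonality to functions of few blocks\<close>

definition depends_on :: "nat set \<Rightarrow> ((nat \<Rightarrow> nat) \<Rightarrow> real) \<Rightarrow> bool" where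
  "depends_on V h \<longleftrightarrow> (\<forall>g g'. (\<forall>i\<in>V. g i = g' i) \<longrightarrow> h g = h g')"

lemma depends_onD: "depends_on V h \<Longrightarrow> (\<And>i. i \<in> V \<Longrightarrow> g i = g' i) \<Longrightarrow> h g = h g'"
  unfolding depends_on_def by blast

definition orthogonal_to_local :: "nat \<Rightarrow> nat \<Rightarrow> nat \<Rightarrow> ((nat \<Rightarrow> real) \<Rightarrow> real) \<Rightarrow> bool" where
  "orthogonal_to_local M N R \<psi> \<longleftrightarrow> (\<forall>V h. V \<subseteq> {1..N} \<longrightarrow> card V \<le> M \<longrightarrow> depends_on V h \<longrightarrow>
     (\<Sum>x\<in>cube (input_len N R). \<psi> x * h (enc_fun R x)) = 0)"

lemma orthogonal_to_localD:
  "orthogonal_to_local M N R \<psi> \<Longrightarrow> V \<subseteq> {1..N} \<Longrightarrow> card V \<le> M \<Longrightarrow> depends_on V h \<Longrightarrow>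
     (\<Sum>x\<in>cube (input_len N R). \<psi> x * h (enc_fun R x)) = 0"
  unfolding orthogonal_to_local_def by blast

text \<open>A function of at most \<open>M\<close> blocks factors through the restriction to some
  selection containing them, so its pairing with \<open>\<psi>\<close> is a pairing with a
  marginal.\<close>

lemma orthogonal_to_local_if_marginals_zero:
  assumes "M \<le> N"
    and zero: "\<And>us y. us \<in> selections M N \<Longrightarrow> y \<in> cube (input_len M R) \<Longrightarrow> marginal N R \<psi> us y = 0"
  shows "orthogonal_to_local M N R \<psi>"
  unfolding orthogonal_to_local_def
proof (intro allI impI)
  fix V h assume V: "V \<subseteq> {1..N}" "card V \<le> M" and h: "depends_on V h"
  obtain us where us: "us \<in> selections M N" "V \<subseteq> set us"
    using selection_exists V assms(1) by blast
  have "\<forall>i\<in>set us. \<exists>k. k \<in> {1..M} \<and> us ! (k - 1) = i"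
  proof
    fix i assume "i \<in> set us"
    then obtain k where "k < M" "us ! k = i"
      using us(1) by (auto simp: in_set_conv_nth selections_def)
    then show "\<exists>k. k \<in> {1..M} \<and> us ! (k - 1) = i" by (intro exI[of _ "Suc k"]) auto
  qed
  \<comment> \<open>\<open>e\<close> sends a block to its 1-based place in \<open>us\<close>;
    composing the function encoded by the restricted input with \<open>e\<close> restores the
    original function on \<open>set us\<close>.\<close>
  then obtain e where e: "\<And>i. i \<in> set us \<Longrightarrow> e i \<in> {1..M}" "\<And>i. i \<in> set us \<Longrightarrow> us ! (e i - 1) = i"
    by metis
  have "h (\<lambda>i. enc_fun R (select R us x) (e i)) = h (enc_fun R x)" for x
    using us(2) e by (intro depends_onD[OF h]) (simp add: subset_iff enc_fun_select[OF us(1)])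
  then show "(\<Sum>x\<in>cube (input_len N R). \<psi> x * h (enc_fun R x)) = 0"
    using sum_marginal[OF us(1), of R \<psi> "\<lambda>y. h (\<lambda>i. enc_fun R y (e i))"] zero[OF us(1)] by simp
qed

text \<open>Expanding one factor of the power and absorbing \<open>r j\<close> into \<open>h\<close>
  enlarges \<open>V\<close> by at most the block \<open>j\<close>, because \<open>U\<close> lies in
  \<open>V\<close> already. Each factor thus costs one block, and the induction has to generalize
  \<open>V\<close> and \<open>h\<close>.\<close>

lemma orthogonal_to_local_power:
  assumes orth: "orthogonal_to_local M N R \<psi>"
    and J: "J \<subseteq> {1..N}" and rdep: "\<And>j. j \<in> J \<Longrightarrow> depends_on (insert j U) (r j)"
    and "U \<subseteq> V" "V \<subseteq> {1..N}" "card V + i \<le> M" "depends_on V h"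
  shows "(\<Sum>x\<in>cube (input_len N R). \<psi> x * (h (enc_fun R x) * (\<Sum>j\<in>J. r j (enc_fun R x)) ^ i)) = 0"
  using assms(4-)
proof (induction i arbitrary: V h)
  case 0
  then show ?case using orthogonal_to_localD[OF orth, of V h] by simp
next
  case (Suc i)
  define g where "g x = enc_fun R x" for x
  have "(\<Sum>x\<in>cube (input_len N R). \<psi> x * (h (g x) * (\<Sum>j\<in>J. r j (g x)) ^ Suc i)) =
    (\<Sum>x\<in>cube (input_len N R). \<Sum>j\<in>J. \<psi> x * ((h (g x) * r j (g x)) * (\<Sum>j\<in>J. r j (g x)) ^ i))"
    by (simp add: sum_distrib_left sum_distrib_right mult_ac)
  also have "\<dots> =
    (\<Sum>j\<in>J. \<Sum>x\<in>cube (input_len N R). \<psi> x * ((h (g x) * r j (g x)) * (\<Sum>j\<in>J. r j (g x)) ^ i))"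
    by (rule sum.swap)
  also have "\<dots> = 0"
  proof (rule sum.neutral, rule ballI)
    fix j assume j: "j \<in> J"
    have fin: "finite V" using Suc.prems(2) finite_subset by blast
    have dep: "depends_on (insert j V) (\<lambda>g. h g * r j g)"
      unfolding depends_on_def
    proof (intro allI impI)
      fix g g' :: "nat \<Rightarrow> nat" assume eq: "\<forall>i\<in>insert j V. g i = g' i"
      have "h g = h g'" using eq by (intro depends_onD[OF Suc.prems(4)]) auto
      moreover have "r j g = r j g'" using eq Suc.prems(1) by (intro depends_onD[OF rdep[OF j]]) auto
      ultimately show "h g * r j g = h g' * r j g'" by simp
    qed
    show "(\<Sum>x\<in>cube (input_len N R). \<psi> x * ((h (g x) * r j (g x)) * (\<Sum>j\<in>J. r j (g x)) ^ i)) = 0"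
      unfolding g_def
    proof (rule Suc.IH[OF _ _ _ dep])
      show "card (insert j V) + i \<le> M" using Suc.prems(3) card_insert_le_m1 fin
        by (auto simp: card_insert_if)
    qed (use Suc.prems J j in auto)
  qed
  finally show ?case by (simp only: g_def)
qed

lemma orthogonal_to_local_poly:
  assumes "orthogonal_to_local M N R \<psi>"
    and "J \<subseteq> {1..N}" and "\<And>j. j \<in> J \<Longrightarrow> depends_on (insert j V) (r j)"
    and "V \<subseteq> {1..N}" "card V + degree q \<le> M" "depends_on V h"
  shows "(\<Sum>x\<in>cube (input_len N R). \<psi> x * (h (enc_fun R x) * poly q (\<Sum>j\<in>J. r j (enc_fun R x)))) = 0"
proof -
  define g where "g x = enc_fun R x" for x
  have "(\<Sum>x\<in>cube (input_len N R). \<psi> x * (h (g x) * poly q (\<Sum>j\<in>J. r j (g x)))) =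
    (\<Sum>x\<in>cube (input_len N R). \<Sum>i\<le>degree q.
       coeff q i * (\<psi> x * (h (g x) * (\<Sum>j\<in>J. r j (g x)) ^ i)))"
    by (simp add: poly_altdef sum_distrib_left mult_ac)
  also have "\<dots> = (\<Sum>i\<le>degree q. coeff q i *
       (\<Sum>x\<in>cube (input_len N R). \<psi> x * (h (g x) * (\<Sum>j\<in>J. r j (g x)) ^ i)))"
    by (subst sum.swap) (simp add: sum_distrib_left)
  also have "\<dots> = 0"
  proof (rule sum.neutral, rule ballI)
    fix i assume "i \<in> {..degree q}"
    then have "card V + i \<le> M" using assms(5) by simp
    then have "(\<Sum>x\<in>cube (input_len N R). \<psi> x * (h (g x) * (\<Sum>j\<in>J. r j (g x)) ^ i)) = 0"
      unfolding g_def
      by (intro orthogonal_to_local_power[OF assms(1-3) _ assms(4) _ assms(6)]) auto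
    then show "coeff q i * (\<Sum>x\<in>cube (input_len N R). \<psi> x * (h (g x) * (\<Sum>j\<in>J. r j (g x)) ^ i)) = 0"
      by simp
  qed
  finally show ?thesis by (simp only: g_def)
qed

text \<open>
  The bound on \<open>M\<close> leaves room for the two-block version of the collision-finding polynomial:
  unless blocks 1 and 2 already collide, the number \<open>t\<close> of later blocks colliding with one of
  them is 0 on 1-to-1 inputs and 2 on 2-to-1 inputs, and a rescaled Chebyshev polynomial in \<open>t\<close> of
  degree \<open>M - 2\<close> separates these two values exactly while staying bounded for all \<open>t \<le> N - 2\<close>.
\<close>

lemma exact_local_function_exists:
  assumes orth: "orthogonal_to_local M N R \<psi>" and "M \<le> N" "0 < M"
    and bound: "8 * real N \<le> 3 * (real M)\<^sup>2"
  obtains q where "\<And>g. inj_on g {1..N} \<Longrightarrow> q g = 1" "\<And>g. k_to_1 2 N g \<Longrightarrow> q g = - 1"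
    "\<And>g. \<bar>q g\<bar> \<le> (1 :: real)" "(\<Sum>x\<in>cube (input_len N R). \<psi> x * q (enc_fun R x)) = 0"
proof (cases "N < 2 * M")
  case True
  \<comment> \<open>Pigeonhole: a 2-to-1 function takes only \<open>N / 2 < M\<close> values, so it
    already collides on the first \<open>M\<close> blocks.\<close>
  define q :: "(nat \<Rightarrow> nat) \<Rightarrow> real" where "q g = (if inj_on g {1..M} then 1 else - 1)" for g
  show thesis
  proof (rule that[of q])
    fix g :: "nat \<Rightarrow> nat"
    show "q g = 1" if "inj_on g {1..N}"
      using inj_on_subset[OF that, of "{1..M}"] \<open>M \<le> N\<close> by (simp add: q_def)
    show "q g = - 1" if "k_to_1 2 N g"
    proof -
      have "\<not> inj_on g {1..M}"
      proof
        assume "inj_on g {1..M}"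
        then have "2 * M = card {j \<in> {1..N}. g j \<in> g ` {1..M}}"
          using card_vimage_2_to_1[OF that, of "{1..M}"] \<open>M \<le> N\<close> by simp
        also have "\<dots> \<le> card {1..N}" by (intro card_mono) auto
        finally show False using True by simp
      qed
      then show ?thesis by (simp add: q_def)
    qed
    show "\<bar>q g\<bar> \<le> 1" by (simp add: q_def)
  next
    have "depends_on {1..M} q"
      unfolding depends_on_def q_def by (metis (no_types, lifting) inj_on_cong)
    then show "(\<Sum>x\<in>cube (input_len N R). \<psi> x * q (enc_fun R x)) = 0"
      using \<open>M \<le> N\<close> by (intro orthogonal_to_localD[OF orth, of "{1..M}"]) auto
  qed
next
  case False
  \<comment> \<open>Two of the \<open>M\<close> available blocks are spent on blocks 1 and 2; the
    others pay for the degree.\<close>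
  define D where "D = M - 2"
  \<comment> \<open>Here \<open>2 * M \<le> N\<close>, so \<open>bound\<close> forces
    \<open>M \<ge> 16 / 3\<close>, which is at least 6 for an integer.\<close>
  have "16 * real M \<le> 8 * real N" using False by simp
  then have "16 * real M \<le> 3 * real M * real M" using bound by (simp add: power2_eq_square)
  then have "16 \<le> 3 * real M" using \<open>0 < M\<close> by simp
  then have M: "6 \<le> M" by linarith
  then have D: "real D = real M - 2" "4 \<le> D" by (auto simp: D_def)
  \<comment> \<open>With pi at most 63/20, the condition of \<open>oscillating_poly_exists\<close>
    for \<open>L = N - 2\<close> becomes a quadratic inequality in \<open>M\<close>, valid from 6
    on.\<close>
  have "pi\<^sup>2 \<le> (63/20)\<^sup>2" using pi_approx by (intro power_mono) auto
  then have "pi\<^sup>2 * (real N - 2) \<le> (63/20)\<^sup>2 * (real N - 2)"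
    using False M by (intro mult_right_mono) auto
  also have "\<dots> \<le> (63/20)\<^sup>2 * (3 / 8 * (real M)\<^sup>2 - 2)" using bound by simp
  also have "\<dots> \<le> 8 * (real D)\<^sup>2"
  proof -
    have "(63/20)\<^sup>2 * (3 / 8 * a\<^sup>2 - 2) \<le> 8 * (a - 2)\<^sup>2" if "6 \<le> a" for a :: real
    proof -
      have "0 \<le> (a - 6)\<^sup>2" by simp
      then have "12 * a \<le> a\<^sup>2 + 36" by (simp add: power2_diff)
      then show ?thesis using that by (simp add: power2_diff power_divide)
    qed
    then show ?thesis using M D(1) by simp
  qed
  finally have "(pi / real D)\<^sup>2 * (real N - 2) \<le> 8"
    using D(2) by (simp add: power_divide pos_divide_le_eq)
  then obtain p :: "real poly" where p: "degree p \<le> D" "poly p 0 = 1" "poly p 2 = -1"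
    "\<And>t. 0 \<le> t \<Longrightarrow> t \<le> real N - 2 \<Longrightarrow> \<bar>poly p t\<bar> \<le> 1"
    using oscillating_poly_exists[of D "real N - 2"] D by auto
  define r :: "nat \<Rightarrow> (nat \<Rightarrow> nat) \<Rightarrow> real" where "r j g = of_bool (g j \<in> g ` {1, 2})" for j g
  define t where "t g = (\<Sum>j\<in>{3..N}. r j g)" for g
  \<comment> \<open>If blocks 1 and 2 collide, the input is not 1-to-1 and -1 is the right
    answer.\<close>
  define q :: "(nat \<Rightarrow> nat) \<Rightarrow> real"
    where "q g = (if g 1 = g 2 then -1 else poly p (t g))" for g
  have t: "t g = real (card {j \<in> {3..N}. g j \<in> g ` {1, 2}})" for g
    unfolding t_def r_def by (subst sum_of_bool_eq) (auto intro!: arg_cong[where f = card])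
  show thesis
  proof (rule that[of q])
    fix g :: "nat \<Rightarrow> nat"
    show "q g = 1" if inj: "inj_on g {1..N}"
    proof -
      have "g j \<noteq> g 1 \<and> g j \<noteq> g 2" if "j \<in> {3..N}" for j
        using inj_onD[OF inj, of j 1] inj_onD[OF inj, of j 2] that by auto
      then have "{j \<in> {3..N}. g j \<in> g ` {1, 2}} = {}" by auto
      then have "t g = 0" by (simp only: t card.empty of_nat_0)
      moreover have "g 1 \<noteq> g 2" using inj_onD[OF inj, of 1 2] False M by auto
      ultimately show ?thesis by (simp add: q_def p)
    qed
    show "q g = - 1" if k2: "k_to_1 2 N g"
    proof (cases "g 1 = g 2")
      case neq: False
      \<comment> \<open>The fibres of blocks 1 and 2 have four points in all; removing 1 and 2
        leaves \<open>t g = 2\<close>.\<close>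
      then have "card {j \<in> {1..N}. g j \<in> g ` {1, 2}} = 2 * card {1, 2 :: nat}"
        using False M by (intro card_vimage_2_to_1[OF k2]) auto
      moreover have "{j \<in> {1..N}. g j \<in> g ` {1, 2}} = {1, 2} \<union> {j \<in> {3..N}. g j \<in> g ` {1, 2}}"
        using False M by auto
      moreover have "card ({1, 2} \<union> {j \<in> {3..N}. g j \<in> g ` {1, 2}}) =
          card {1, 2 :: nat} + card {j \<in> {3..N}. g j \<in> g ` {1, 2}}"
        by (intro card_Un_disjoint) auto
      ultimately have "card {j \<in> {3..N}. g j \<in> g ` {1, 2}} = 2" by simp
      then show ?thesis using neq p(3) by (simp only: q_def t) simp
    qed (simp add: q_def)
    have "card {j \<in> {3..N}. g j \<in> g ` {1, 2}} \<le> card {3..N}" by (intro card_mono) auto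
    then have "t g \<le> real N - 2" using False M by (simp only: t card_atLeastAtMost)
    moreover have "0 \<le> t g" by (simp only: t of_nat_0_le_iff)
    ultimately show "\<bar>q g\<bar> \<le> 1" using p(4) by (simp add: q_def)
  next
    define g where "g x = enc_fun R x" for x
    \<comment> \<open>The case distinction in \<open>q\<close> becomes the difference
      \<open>h2 * poly p t - h1\<close>, whose terms are handled separately by
      orthogonality.\<close>
    define h1 h2 :: "(nat \<Rightarrow> nat) \<Rightarrow> real"
      where "h1 f = of_bool (f 1 = f 2)" and "h2 f = of_bool (f 1 \<noteq> f 2)" for f
    have dep: "depends_on {1, 2} h1" "depends_on {1, 2} h2" "depends_on (insert j {1, 2}) (r j)" for j
      by (auto simp: depends_on_def h1_def h2_def r_def)
    have sub: "{1, 2} \<subseteq> {1..N}" using False M by auto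
    have "card {1, 2 :: nat} + degree p \<le> M" using p(1) M by (simp add: D_def)
    then have "(\<Sum>x\<in>cube (input_len N R). \<psi> x * (h2 (g x) * poly p (t (g x)))) = 0"
      unfolding g_def t_def
      by (intro orthogonal_to_local_poly[OF orth, where V = "{1, 2}"] dep sub) auto
    moreover have "(\<Sum>x\<in>cube (input_len N R). \<psi> x * h1 (g x)) = 0"
      unfolding g_def using M by (intro orthogonal_to_localD[OF orth sub] dep) auto
    moreover have "\<psi> x * q (g x) = \<psi> x * (h2 (g x) * poly p (t (g x))) - \<psi> x * h1 (g x)" for x
      by (simp add: q_def h1_def h2_def)
    ultimately show "(\<Sum>x\<in>cube (input_len N R). \<psi> x * q (enc_fun R x)) = 0"
      unfolding g_def[symmetric] by (simp only: sum_subtractf)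
  qed
qed

section \<open>The dual polynomial\<close>

lemma sum_cube_split:
  fixes f :: "(nat \<Rightarrow> real) \<Rightarrow> real"
  assumes "N > 0"
  shows "(\<Sum>x\<in>cube (input_len N R). f x) =
    (\<Sum>x\<in>T_set 1 N R. f x) + (\<Sum>x\<in>T_set 2 N R. f x) + (\<Sum>x\<in>B_set N R. f x)"
proof -
  \<comment> \<open>Disjointness needs a block to look at: for \<open>N = 0\<close> every function
    is vacuously both 1-to-1 and 2-to-1.\<close>
  have "\<not> (k_to_1 1 N g \<and> k_to_1 2 N g)" for g
  proof -
    have "1 \<in> {1..N}" using assms by simp
    then have "k_to_1 k N g \<Longrightarrow> card {j \<in> {1..N}. j \<noteq> 1 \<and> g j = g 1} + 1 = k" for k
      unfolding k_to_1_def by blast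
    from this[of 1] this[of 2] show ?thesis by linarith
  qed
  then have "T_set 1 N R \<inter> T_set 2 N R = {}" by (auto simp: T_set_def)
  moreover have sub: "T_set k N R \<subseteq> cube (input_len N R)" for k by (auto simp: T_set_def)
  moreover have "finite (T_set k N R)" for k using sub finite_cube by (rule finite_subset)
  ultimately have "(\<Sum>x\<in>T_set 1 N R \<union> T_set 2 N R. f x) =
      (\<Sum>x\<in>T_set 1 N R. f x) + (\<Sum>x\<in>T_set 2 N R. f x)"
    by (intro sum.union_disjoint) auto
  moreover have "(\<Sum>x\<in>cube (input_len N R). f x) =
      (\<Sum>x\<in>cube (input_len N R) - (T_set 1 N R \<union> T_set 2 N R). f x) +
      (\<Sum>x\<in>T_set 1 N R \<union> T_set 2 N R. f x)"
    using sub by (intro sum.subset_diff finite_cube) auto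
  ultimately show ?thesis by (simp add: B_set_def)
qed

text \<open>\<open>E\<close> imitates \<open>I\<close> times the collision function: the deviation
  on \<open>T_set 2 N R\<close> is charged to the norm of \<open>\<psi>\<close>, and
  \<open>B_set N R\<close> is estimated by its worst case. It serves both for the sum of all
  marginals and, with \<open>\<eta> = 0\<close>, for the exact local function.\<close>

lemma Col_correlation_ge:
  fixes \<psi> E :: "(nat \<Rightarrow> real) \<Rightarrow> real"
  assumes "N > 0" "0 \<le> \<eta>"
    and T1: "\<And>x. x \<in> T_set 1 N R \<Longrightarrow> E x = I"
    and T2: "\<And>x. x \<in> T_set 2 N R \<Longrightarrow> \<bar>E x + I\<bar> \<le> \<eta>"
    and B: "\<And>x. x \<in> B_set N R \<Longrightarrow> \<bar>E x\<bar> \<le> I"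
  shows "(\<Sum>x\<in>cube (input_len N R). \<psi> x * E x) \<ge>
    I * ((\<Sum>x\<in>T_set 1 N R. \<psi> x) - (\<Sum>x\<in>T_set 2 N R. \<psi> x) - (\<Sum>x\<in>B_set N R. \<bar>\<psi> x\<bar>))
      - \<eta> * (\<Sum>x\<in>cube (input_len N R). \<bar>\<psi> x\<bar>)"
proof -
  have 1: "(\<Sum>x\<in>T_set 1 N R. \<psi> x * E x) = I * (\<Sum>x\<in>T_set 1 N R. \<psi> x)"
    by (simp add: T1 sum_distrib_left mult.commute del: One_nat_def)
  have "(\<Sum>x\<in>T_set 2 N R. - I * \<psi> x - \<eta> * \<bar>\<psi> x\<bar>) \<le> (\<Sum>x\<in>T_set 2 N R. \<psi> x * E x)"
  proof (rule sum_mono)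
    fix x assume "x \<in> T_set 2 N R"
    then have "\<bar>\<psi> x\<bar> * \<bar>E x + I\<bar> \<le> \<bar>\<psi> x\<bar> * \<eta>" by (intro mult_left_mono T2) auto
    then have "\<bar>\<psi> x * (E x + I)\<bar> \<le> \<eta> * \<bar>\<psi> x\<bar>" by (simp add: abs_mult mult.commute)
    then show "- I * \<psi> x - \<eta> * \<bar>\<psi> x\<bar> \<le> \<psi> x * E x" by (simp add: abs_le_iff algebra_simps)
  qed
  then have 2: "- I * (\<Sum>x\<in>T_set 2 N R. \<psi> x) - \<eta> * (\<Sum>x\<in>T_set 2 N R. \<bar>\<psi> x\<bar>)
      \<le> (\<Sum>x\<in>T_set 2 N R. \<psi> x * E x)"
    by (simp only: sum_subtractf sum_distrib_left)
  have "(\<Sum>x\<in>B_set N R. - I * \<bar>\<psi> x\<bar>) \<le> (\<Sum>x\<in>B_set N R. \<psi> x * E x)"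
  proof (rule sum_mono)
    fix x assume "x \<in> B_set N R"
    then have "\<bar>\<psi> x\<bar> * \<bar>E x\<bar> \<le> \<bar>\<psi> x\<bar> * I" by (intro mult_left_mono B) auto
    then have "\<bar>\<psi> x * E x\<bar> \<le> I * \<bar>\<psi> x\<bar>" by (simp add: abs_mult mult.commute)
    then show "- I * \<bar>\<psi> x\<bar> \<le> \<psi> x * E x" by (simp add: abs_le_iff)
  qed
  then have 3: "- I * (\<Sum>x\<in>B_set N R. \<bar>\<psi> x\<bar>) \<le> (\<Sum>x\<in>B_set N R. \<psi> x * E x)"
    by (simp only: sum_distrib_left)
  have "(\<Sum>x\<in>T_set 2 N R. \<bar>\<psi> x\<bar>) \<le> (\<Sum>x\<in>cube (input_len N R). \<bar>\<psi> x\<bar>)"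
    by (intro sum_mono2 finite_cube) (auto simp: T_set_def)
  then have "\<eta> * (\<Sum>x\<in>T_set 2 N R. \<bar>\<psi> x\<bar>) \<le> \<eta> * (\<Sum>x\<in>cube (input_len N R). \<bar>\<psi> x\<bar>)"
    using assms(2) by (rule mult_left_mono)
  then show ?thesis
    using 1 2 3 unfolding sum_cube_split[OF assms(1), where f = "\<lambda>x. \<psi> x * E x"]
    by (simp add: algebra_simps)
qed

section \<open>The sum of all marginals, for \<delta> at most 1/2\<close>

lemma dual_poly_ED_small_error:
  assumes "N > 0" "M \<le> N" "0 < \<delta>" "\<delta> \<le> 1 / 2"
    and dual: "dual_poly_Col N R (1 - \<delta>) d \<psi>"
    and p: "exp (- (real M * (real M - 1) / (2 * real N))) \<le> \<delta> / 2"
  shows "dual_poly_ED M R (1 - 2 * \<delta>) d (\<lambda>y. \<Sum>us\<in>selections M N. marginal N R \<psi> us y)"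
proof -
  define S where "S = selections M N"
  define I where "I = real (card S)"
  define W where "W = (\<Sum>x\<in>cube (input_len N R). \<bar>\<psi> x\<bar>)"
  define \<phi> where "\<phi> y = (\<Sum>us\<in>S. marginal N R \<psi> us y)" for y
  define E where "E x = (\<Sum>us\<in>S. ED M R (select R us x))" for x
  obtain us where "us \<in> S" using selection_exists[of "{}" N M] \<open>M \<le> N\<close> by (auto simp: S_def)
  then have I: "0 < I" using finite_selections card_gt_0_iff by (fastforce simp: I_def S_def)
  have sum_\<phi>: "(\<Sum>y\<in>cube (input_len M R). \<phi> y * F y) =
      (\<Sum>us\<in>S. \<Sum>y\<in>cube (input_len M R). marginal N R \<psi> us y * F y)" for F
    unfolding \<phi>_def sum_distrib_right by (rule sum.swap)
  have "pure_high_degree (input_len M R) d (marginal N R \<psi> us)" if "us \<in> S" for us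
    using that dual pure_high_degree_marginal by (auto simp: S_def dual_poly_Col_def)
  then have phd: "pure_high_degree (input_len M R) d \<phi>"
    unfolding pure_high_degree_def sum_\<phi> by (auto intro!: sum.neutral)
  have "(\<Sum>y\<in>cube (input_len M R). \<bar>\<phi> y\<bar>) \<le>
      (\<Sum>y\<in>cube (input_len M R). \<Sum>us\<in>S. \<bar>marginal N R \<psi> us y\<bar>)"
    unfolding \<phi>_def by (intro sum_mono sum_abs)
  also have "\<dots> = (\<Sum>us\<in>S. \<Sum>y\<in>cube (input_len M R). \<bar>marginal N R \<psi> us y\<bar>)" by (rule sum.swap)
  also have "\<dots> \<le> (\<Sum>us\<in>S. W)"
    unfolding W_def by (intro sum_mono sum_abs_marginal_le) (simp add: S_def)
  finally have norm: "(\<Sum>y\<in>cube (input_len M R). \<bar>\<phi> y\<bar>) \<le> I * W" by (simp add: I_def)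
  \<comment> \<open>Collision-free selections contribute 1 and all others -1.\<close>
  have E: "E x = 2 * real (card {us \<in> S. distinct (map (enc_fun R x) us)}) - I" for x
  proof -
    have "E x = (\<Sum>us\<in>S. 2 * of_bool (distinct (map (enc_fun R x) us)) - 1)"
      unfolding E_def by (intro sum.cong refl) (simp add: ED_select S_def)
    also have "\<dots> = 2 * (\<Sum>us\<in>S. of_bool (distinct (map (enc_fun R x) us))) - I"
      by (simp add: sum_subtractf sum_distrib_left I_def)
    also have "(\<Sum>us\<in>S. of_bool (distinct (map (enc_fun R x) us)) :: real) =
        real (card {us \<in> S. distinct (map (enc_fun R x) us)})"
      by (subst sum_of_bool_eq)
         (auto simp: S_def finite_selections intro!: arg_cong[where f = card])
    finally show ?thesis .
  qed
  have "I * ((\<Sum>x\<in>T_set 1 N R. \<psi> x) - (\<Sum>x\<in>T_set 2 N R. \<psi> x) - (\<Sum>x\<in>B_set N R. \<bar>\<psi> x\<bar>)) -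
      (\<delta> * I) * W \<le> (\<Sum>x\<in>cube (input_len N R). \<psi> x * E x)"
    unfolding W_def
  proof (rule Col_correlation_ge)
    fix x
    define A where "A = {us \<in> S. distinct (map (enc_fun R x) us)}"
    have "card A \<le> card S" by (intro card_mono) (auto simp: A_def S_def finite_selections)
    then have AI: "real (card A) \<le> I" by (simp add: I_def)
    show "\<bar>E x\<bar> \<le> I" using AI unfolding E A_def[symmetric] by (simp add: abs_le_iff)
    show "E x = I" if "x \<in> T_set 1 N R"
    proof -
      have "inj_on (enc_fun R x) {1..N}" using that k_to_1_1_iff_inj_on unfolding T_set_def by blast
      then have "A = S"
        unfolding A_def S_def selections_def by (auto simp: distinct_map intro: inj_on_subset)
      then show ?thesis unfolding E A_def[symmetric] by (simp add: I_def)
    qed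
    show "\<bar>E x + I\<bar> \<le> \<delta> * I" if "x \<in> T_set 2 N R"
    proof -
      have "k_to_1 2 N (enc_fun R x)" using that by (simp add: T_set_def)
      then have "real (card A) \<le> I * exp (- (real M * (real M - 1) / (2 * real N)))"
        using birthday_bound \<open>M \<le> N\<close> by (simp add: A_def S_def I_def)
      \<comment> \<open>\<open>E x + I\<close> is twice the number of collision-free selections, so
        the birthday bound \<delta>/2 becomes an error of \<open>\<delta> * I\<close>.\<close>
      also have "\<dots> \<le> I * (\<delta> / 2)" using p I by (intro mult_left_mono) auto
      finally show ?thesis unfolding E A_def[symmetric] by (simp add: mult.commute)
    qed
  qed (use assms I in auto)
  moreover have "(\<Sum>y\<in>cube (input_len M R). \<phi> y * ED M R y) =
      (\<Sum>x\<in>cube (input_len N R). \<psi> x * E x)"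
  proof -
    have "(\<Sum>y\<in>cube (input_len M R). \<phi> y * ED M R y) =
        (\<Sum>us\<in>S. \<Sum>x\<in>cube (input_len N R). \<psi> x * ED M R (select R us x))"
      unfolding sum_\<phi> by (intro sum.cong refl sum_marginal) (simp add: S_def)
    then show ?thesis unfolding E_def sum_distrib_left by (simp only: sum.swap[of _ S])
  qed
  moreover have "I * ((1 - \<delta>) * W) <
      I * ((\<Sum>x\<in>T_set 1 N R. \<psi> x) - (\<Sum>x\<in>T_set 2 N R. \<psi> x) - (\<Sum>x\<in>B_set N R. \<bar>\<psi> x\<bar>))"
    using dual I unfolding dual_poly_Col_def W_def by (intro mult_strict_left_mono) auto
  \<comment> \<open>The upper bound on the norm is useful because \<open>1 - 2 * \<delta>\<close> is
    nonnegative. The loss \<open>\<delta> * I * W\<close> then takes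
    \<open>(1 - \<delta>) * I * W\<close> down to \<open>(1 - 2 * \<delta>) * I * W\<close>.\<close>
  moreover have "(1 - 2 * \<delta>) * (\<Sum>y\<in>cube (input_len M R). \<bar>\<phi> y\<bar>) \<le> (1 - 2 * \<delta>) * (I * W)"
    using norm assms(4) by (intro mult_left_mono) auto
  ultimately have "(1 - 2 * \<delta>) * (\<Sum>y\<in>cube (input_len M R). \<bar>\<phi> y\<bar>) <
      (\<Sum>y\<in>cube (input_len M R). \<phi> y * ED M R y)"
    by (simp add: algebra_simps)
  with phd show ?thesis unfolding dual_poly_ED_def \<phi>_def S_def by blast
qed

section \<open>A single marginal, for \<delta> above 1/2\<close>

lemma nonzero_marginal_exists:
  assumes "N > 0" "M \<le> N" "0 < M" "\<epsilon> \<ge> 0" "8 * real N \<le> 3 * (real M)\<^sup>2"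
    and dual: "dual_poly_Col N R \<epsilon> d \<psi>"
  obtains us y where "us \<in> selections M N" "y \<in> cube (input_len M R)" "marginal N R \<psi> us y \<noteq> 0"
proof (rule ccontr)
  assume "\<not> thesis"
  then have "orthogonal_to_local M N R \<psi>"
    using that by (intro orthogonal_to_local_if_marginals_zero assms) blast
  then obtain q where q: "\<And>g. inj_on g {1..N} \<Longrightarrow> q g = 1" "\<And>g. k_to_1 2 N g \<Longrightarrow> q g = - 1"
    "\<And>g. \<bar>q g\<bar> \<le> (1 :: real)" "(\<Sum>x\<in>cube (input_len N R). \<psi> x * q (enc_fun R x)) = 0"
    using exact_local_function_exists assms(2,3,5) by blast
  have "1 * ((\<Sum>x\<in>T_set 1 N R. \<psi> x) - (\<Sum>x\<in>T_set 2 N R. \<psi> x) - (\<Sum>x\<in>B_set N R. \<bar>\<psi> x\<bar>)) -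
      0 * (\<Sum>x\<in>cube (input_len N R). \<bar>\<psi> x\<bar>) \<le> (\<Sum>x\<in>cube (input_len N R). \<psi> x * q (enc_fun R x))"
  proof (rule Col_correlation_ge)
    fix x
    show "q (enc_fun R x) = 1" if "x \<in> T_set 1 N R"
      using that k_to_1_1_iff_inj_on unfolding T_set_def by (blast intro: q(1))
    show "\<bar>q (enc_fun R x) + 1\<bar> \<le> 0" if "x \<in> T_set 2 N R"
      using that by (simp add: T_set_def q(2))
    show "\<bar>q (enc_fun R x)\<bar> \<le> 1" by (rule q(3))
  qed (use assms in auto)
  \<comment> \<open>So the correlation of \<open>\<psi>\<close> with the collision problem is
    strictly positive, yet it was just bounded by a pairing that is 0.\<close>
  moreover have "0 \<le> \<epsilon> * (\<Sum>x\<in>cube (input_len N R). \<bar>\<psi> x\<bar>)"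
    using assms(4) by (intro mult_nonneg_nonneg sum_nonneg) auto
  ultimately show False using dual q(4) unfolding dual_poly_Col_def by simp
qed

text \<open>For a nonzero function the right side is negative, so a nonnegative pairing with
  \<open>ED\<close> suffices; the sign \<open>s\<close> secures it.\<close>

lemma dual_poly_ED_negative_error:
  assumes "\<epsilon> < 0" "pure_high_degree (input_len M R) d \<phi>" "y \<in> cube (input_len M R)" "\<phi> y \<noteq> 0"
  shows "\<exists>\<phi>'. dual_poly_ED M R \<epsilon> d \<phi>'"
proof -
  define C where "C = (\<Sum>y\<in>cube (input_len M R). \<phi> y * ED M R y)"
  define s :: real where "s = (if C \<ge> 0 then 1 else - 1)"
  have s: "\<bar>s\<bar> = 1" by (simp add: s_def)
  have "0 < (\<Sum>y\<in>cube (input_len M R). \<bar>\<phi> y\<bar>)"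
    using assms(3,4) by (intro sum_pos2[where i = y] finite_cube) auto
  then have "\<epsilon> * (\<Sum>y\<in>cube (input_len M R). \<bar>s * \<phi> y\<bar>) < 0"
    using assms(1) by (simp add: abs_mult s mult_neg_pos)
  also have "0 \<le> s * C" by (simp add: s_def)
  also have "s * C = (\<Sum>y\<in>cube (input_len M R). (s * \<phi> y) * ED M R y)"
    by (simp add: C_def sum_distrib_left mult.assoc)
  finally have "\<epsilon> * (\<Sum>y\<in>cube (input_len M R). \<bar>s * \<phi> y\<bar>) <
      (\<Sum>y\<in>cube (input_len M R). (s * \<phi> y) * ED M R y)" .
  moreover have "pure_high_degree (input_len M R) d (\<lambda>y. s * \<phi> y)"
    using assms(2) unfolding pure_high_degree_def
    by (simp add: mult.assoc sum_distrib_left[symmetric])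
  ultimately have "dual_poly_ED M R \<epsilon> d (\<lambda>y. s * \<phi> y)" unfolding dual_poly_ED_def by simp
  then show ?thesis by (intro exI[where x = "\<lambda>y. s * \<phi> y"])
qed

theorem mainTheorem2:
  fixes N M R d :: nat and \<delta> :: real and \<psi> :: "(nat \<Rightarrow> real) \<Rightarrow> real"
  assumes "N > 0" and "M > 0" and "R > 0"
    and "M \<le> N"
    and "\<exists>k. R = 2 ^ k"
    and "0 < \<delta>" and "\<delta> < 1"
    and "dual_poly_Col N R (1 - \<delta>) d \<psi>"
    and "real M \<ge> 2 * sqrt (real N * ln (2 / \<delta>))"
  shows "\<exists>\<phi> :: (nat \<Rightarrow> real) \<Rightarrow> real. dual_poly_ED M R (1 - 2 * \<delta>) d \<phi>"
proof -
  \<comment> \<open>Since \<delta> is below 1, the logarithm is at least 2/3; this yields the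
    \<delta>-free bound \<open>8 * N \<le> 3 * M^2\<close>, used in both cases.\<close>
  have ln: "ln 2 \<le> ln (2 / \<delta>)" using assms(6,7) by (simp add: field_simps)
  then have ln23: "2 / 3 \<le> ln (2 / \<delta>)" using ln2_ge_two_thirds by linarith
  have "(2 * sqrt (real N * ln (2 / \<delta>)))\<^sup>2 \<le> (real M)\<^sup>2"
    using assms(9) ln23 by (intro power_mono) auto
  then have sq: "4 * (real N * ln (2 / \<delta>)) \<le> (real M)\<^sup>2"
    using ln23 by (simp add: power_mult_distrib)
  have "real N * (2 / 3) \<le> real N * ln (2 / \<delta>)" using ln23 by (intro mult_left_mono) auto
  then have bound: "8 * real N \<le> 3 * (real M)\<^sup>2" using sq by linarith
  show ?thesis
  proof (cases "\<delta> \<le> 1 / 2")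
    case True
    have "M \<noteq> 1" using bound assms(1) by auto
    then have M: "2 \<le> M" using assms(2) by linarith
    \<comment> \<open>From \<open>M \<ge> 2\<close> follows \<open>M - 1 \<ge> M / 2\<close>, so the
      birthday exponent is at least \<open>M^2 / (4 * N)\<close>; the factor 2 in the hypothesis on
      \<open>M\<close> makes this at least \<open>ln (2 / \<delta>)\<close>.\<close>
    have "(real M)\<^sup>2 \<le> 2 * (real M * (real M - 1))" using M by (simp add: power2_eq_square)
    then have "2 * real N * ln (2 / \<delta>) \<le> real M * (real M - 1)" using sq by simp
    then have "ln (2 / \<delta>) \<le> real M * (real M - 1) / (2 * real N)"
      using assms(1) by (simp add: field_simps)
    then have "exp (- (real M * (real M - 1) / (2 * real N))) \<le> exp (- ln (2 / \<delta>))" by simp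
    also have "\<dots> = \<delta> / 2" using assms(6) by (simp add: exp_minus)
    finally show ?thesis using dual_poly_ED_small_error True assms by blast
  next
    case False
    obtain us y where "us \<in> selections M N" "y \<in> cube (input_len M R)" "marginal N R \<psi> us y \<noteq> 0"
      using nonzero_marginal_exists[of N M "1 - \<delta>" R d \<psi>] bound assms by auto
    moreover have "pure_high_degree (input_len N R) d \<psi>"
      using assms(8) by (simp add: dual_poly_Col_def)
    ultimately show ?thesis
      using False
      by (intro dual_poly_ED_negative_error[where \<phi> = "marginal N R \<psi> us" and y = y]
          pure_high_degree_marginal) auto
  qed
qed

end
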